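(* Let $d_0,d_1,d_2,r$ be positive integers and let $\mathbf{d}=(d_0,d_1,d_2)$ with $d_1\ge\binom{r+d_0-1}{r}$. Then the neuromanifold itself is filling, i.e. $\mathcal{M}_{\mathbf{d},r}=(\mathrm{Sym}_r(\mathbb{R}^{d_0}))^{d_2}$.
   Context: $\mathrm{Sym}_d(\mathbb{R}^n)$ denotes the real vector space of homogeneous polynomials of degree $d$ in $n$ variables. A polynomial neural network (PNN) with architecture $(\mathbf{d}=(d_0,\dots,d_L),r)$ is the map $p_{\mathbf{w}}=W_L\circ\rho_r\circ W_{L-1}\circ\cdots\circ\rho_r\circ W_1:\mathbb{R}^{d_0}\to\mathbb{R}^{d_L}$, where $W_i\in\mathbb{R}^{d_i\times d_{i-1}}$ are linear maps (weights) $\mathbf{w}=(W_1,\dots,W_L)$ and $\rho_r$ raises each coordinate to the $r$-th power. The parameter map is $\Psi_{\mathbf{d},r}:\mathbf{w}\mapsto p_{\mathbf{w}}\in(\mathrm{Sym}_{r^{L-1}}(\mathbb{R}^{d_0}))^{d_L}$, and the neuromanifold $\mathcal{M}_{\mathbf{d},r}$ is the image of $\Psi_{\mathbf{d},r}$. *)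

theory Defs
  imports Complex_Main "HOL-Library.FuncSet" "Jordan_Normal_Form.Matrix"
begin

text \<open>
  The space \<open>\<real>\<^sup>n\<close> is \<open>carrier_vec n\<close>. Maps and polynomials on it are represented by functions
  that are \<open>undefined\<close> outside \<open>carrier_vec n\<close>, so that equality of functions is equality of
  maps on \<open>\<real>\<^sup>n\<close>. As \<open>\<real>\<close> is infinite, real polynomials in \<open>n\<close> variables may be identified with
  the polynomial functions on \<open>\<real>\<^sup>n\<close>.
\<close>

definition multi_indices :: "nat \<Rightarrow> nat \<Rightarrow> (nat \<Rightarrow> nat) set" where
  "multi_indices n d = {\<alpha> \<in> {..<n} \<rightarrow>\<^sub>E UNIV. (\<Sum>i<n. \<alpha> i) = d}"

lemma finite_multi_indices [simp]: "finite (multi_indices n d)"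
proof (rule finite_subset)
  show "multi_indices n d \<subseteq> {..<n} \<rightarrow>\<^sub>E {..d}"
  proof
    fix \<alpha> assume \<alpha>: "\<alpha> \<in> multi_indices n d"
    then have "\<alpha> i \<le> d" if "i < n" for i
      using that member_le_sum[of i "{..<n}" \<alpha>] by (auto simp: multi_indices_def)
    with \<alpha> show "\<alpha> \<in> {..<n} \<rightarrow>\<^sub>E {..d}"
      unfolding multi_indices_def PiE_def Pi_def by blast
  qed
qed (intro finite_PiE; simp)

definition Sym :: "nat \<Rightarrow> nat \<Rightarrow> (real vec \<Rightarrow> real) set" where
  "Sym d n = {f. \<exists>c :: (nat \<Rightarrow> nat) \<Rightarrow> real.
      f = (\<lambda>x\<in>carrier_vec n. \<Sum>\<alpha>\<in>multi_indices n d. c \<alpha> * (\<Prod>i<n. x $ i ^ \<alpha> i))}"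

text \<open>An \<open>m\<close>-tuple of polynomials is identified with the map into \<open>\<real>\<^sup>m\<close> having them as
  coordinates.\<close>

definition Sym_tuples :: "nat \<Rightarrow> nat \<Rightarrow> nat \<Rightarrow> (real vec \<Rightarrow> real vec) set" where
  "Sym_tuples d n m = {F \<in> carrier_vec n \<rightarrow>\<^sub>E carrier_vec m.
      \<forall>j<m. (\<lambda>x\<in>carrier_vec n. F x $ j) \<in> Sym d n}"

definition activation :: "nat \<Rightarrow> real vec \<Rightarrow> real vec" where
  "activation r v = map_vec (\<lambda>t. t ^ r) v"

text \<open>The weights \<open>(W\<^sub>1, \<dots>, W\<^sub>L)\<close> are given in the order in which they are applied; no activation
  follows the last layer.\<close>

fun pnn :: "nat \<Rightarrow> real mat list \<Rightarrow> real vec \<Rightarrow> real vec" where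
  "pnn r [] x = x"
| "pnn r [W] x = W *\<^sub>v x"
| "pnn r (W # W' # Ws) x = pnn r (W' # Ws) (activation r (W *\<^sub>v x))"

text \<open>The architecture is the list \<open>[d\<^sub>0, \<dots>, d\<^sub>L]\<close>; as lists are indexed from \<open>0\<close>, the entry
  \<open>Ws ! i\<close> is the matrix \<open>W\<^bsub>i+1\<^esub>\<close>.\<close>

definition weights :: "nat list \<Rightarrow> real mat list set" where
  "weights ds = {Ws. length ds = Suc (length Ws) \<and>
      (\<forall>i<length Ws. Ws ! i \<in> carrier_mat (ds ! Suc i) (ds ! i))}"

definition param_map :: "nat list \<Rightarrow> nat \<Rightarrow> real mat list \<Rightarrow> real vec \<Rightarrow> real vec" where
  "param_map ds r Ws = restrict (pnn r Ws) (carrier_vec (ds ! 0))"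

definition neuromanifold :: "nat list \<Rightarrow> nat \<Rightarrow> (real vec \<Rightarrow> real vec) set" where
  "neuromanifold ds r = param_map ds r ` weights ds"

end

theory Submission
  imports Defs "Jordan_Normal_Form.Determinant"
begin

text \<open>
  By the multinomial theorem the coefficient of \<open>x\<^sup>\<beta>\<close> in the power \<open>(\<gamma> \<cdot> x)\<^sup>r\<close> is a nonzero
  multiple of \<open>\<gamma>\<^sup>\<beta>\<close>. The powers \<open>(\<gamma> \<cdot> x)\<^sup>r\<close>, with \<open>\<gamma>\<close> running through the multi-indices of
  degree \<open>r\<close>, therefore span the forms of degree \<open>r\<close> as soon as the square matrix with entries
  \<open>\<gamma>\<^sup>\<beta>\<close> is invertible. Its inverse is given by the coefficients of Lagrange polynomials: the product
  of the \<open>x\<^sub>i - (k/r) (x\<^sub>1 + \<dots> + x\<^sub>n)\<close> over all \<open>i\<close> and all \<open>k < \<alpha>\<^sub>i\<close> is a form of degree \<open>r\<close>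
  which, among the multi-indices of degree \<open>r\<close>, vanishes exactly at those different from \<open>\<alpha>\<close>.
  There are \<open>(r + n - 1) choose r\<close> multi-indices, so the \<open>\<gamma>\<close> fit into the rows of the first
  weight matrix, and the second one holds the coefficients.
\<close>

section \<open>Multi-indices, monomials and the multinomial theorem\<close>

lemma card_multi_indices: "card (multi_indices n d) = (d + n - 1) choose d"
proof -
  let ?L = "{l :: nat list. length l = n \<and> sum_list l = d}"
  \<comment> \<open>A multi-index is the list of its values, and stars and bars counts such
    lists.\<close>
  have "bij_betw (\<lambda>l. \<lambda>i\<in>{..<n}. l ! i) ?L (multi_indices n d)"
    by (rule bij_betw_byWitness[where f' = "\<lambda>\<alpha>. map \<alpha> [0..<n]"])
      (auto simp: multi_indices_def sum_list_sum_nth atLeast0LessThan PiE_def extensional_def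
        fun_eq_iff list_eq_iff_nth_eq intro!: sum.cong)
  then show ?thesis
    by (simp only: card_length_sum_list flip: bij_betw_same_card)
qed

text \<open>Points are functions here instead of vectors, so that a multi-index, cast to the reals,
  can also serve as a point of evaluation.\<close>

definition monomial :: "nat \<Rightarrow> (nat \<Rightarrow> nat) \<Rightarrow> (nat \<Rightarrow> real) \<Rightarrow> real" where
  "monomial n \<beta> x = (\<Prod>i<n. x i ^ \<beta> i)"

lemma monomial_mult: "monomial n \<beta> (\<lambda>i. x i * y i) = monomial n \<beta> x * monomial n \<beta> y"
  by (simp add: monomial_def power_mult_distrib prod.distrib)

lemma monomial_upd_Suc:
  assumes "j < n"
  shows "monomial n (\<beta>(j := Suc (\<beta> j))) x = x j * monomial n \<beta> x"
  using assms by (simp add: monomial_def prod.remove[of "{..<n}" j])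

lemma multi_indices_0: "multi_indices n 0 = {\<lambda>i\<in>{..<n}. 0}"
  by (auto simp: multi_indices_def PiE_def extensional_def fun_eq_iff)

lemma multi_indices_upd_Suc:
  assumes "j < n" "\<beta> \<in> multi_indices n d"
  shows "\<beta>(j := Suc (\<beta> j)) \<in> multi_indices n (Suc d)"
  using assms by (auto simp: multi_indices_def PiE_def extensional_def sum.remove[of "{..<n}" j])

lemma multi_indices_upd_pred:
  assumes "j < n" "\<beta> \<in> multi_indices n (Suc d)" "\<beta> j > 0"
  shows "\<beta>(j := \<beta> j - 1) \<in> multi_indices n d"
  using assms by (auto simp: multi_indices_def PiE_def extensional_def sum.remove[of "{..<n}" j])

text \<open>Raising the exponent at \<open>j\<close> is a bijection onto the multi-indices of degree
  \<open>Suc d\<close> that are positive at \<open>j\<close>; all others get coefficient 0. Both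
  later inductions on the degree rest on this.\<close>

lemma var_times_form:
  assumes "j < n"
  shows "x j * (\<Sum>\<beta>\<in>multi_indices n d. c \<beta> * monomial n \<beta> x) =
    (\<Sum>\<beta>\<in>multi_indices n (Suc d).
      (if \<beta> j > 0 then c (\<beta>(j := \<beta> j - 1)) else 0) * monomial n \<beta> x)"
proof -
  have "x j * (\<Sum>\<beta>\<in>multi_indices n d. c \<beta> * monomial n \<beta> x) =
      (\<Sum>\<beta>\<in>multi_indices n d. c \<beta> * monomial n (\<beta>(j := Suc (\<beta> j))) x)"
    using assms by (simp add: sum_distrib_left monomial_upd_Suc mult.left_commute)
  also have "\<dots> = (\<Sum>\<beta>\<in>{\<beta>\<in>multi_indices n (Suc d). \<beta> j > 0}.
      c (\<beta>(j := \<beta> j - 1)) * monomial n \<beta> x)"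
    by (rule sum.reindex_bij_witness[of _ "\<lambda>\<beta>. \<beta>(j := \<beta> j - 1)" "\<lambda>\<beta>. \<beta>(j := Suc (\<beta> j))"])
      (use assms in \<open>auto intro: multi_indices_upd_Suc multi_indices_upd_pred[simplified]\<close>)
  also have "\<dots> = (\<Sum>\<beta>\<in>multi_indices n (Suc d).
      (if \<beta> j > 0 then c (\<beta>(j := \<beta> j - 1)) else 0) * monomial n \<beta> x)"
    by (rule sum.mono_neutral_cong_left) auto
  finally show ?thesis .
qed

text \<open>The coefficients stay abstract instead of being given by factorials: what matters is
  that they do not depend on \<open>y\<close> and, being positive, can be divided by.\<close>

lemma multinomial_theorem:
  obtains m :: "(nat \<Rightarrow> nat) \<Rightarrow> real"
  where "\<And>\<beta>. \<beta> \<in> multi_indices n d \<Longrightarrow> m \<beta> > 0"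
    and "\<And>y. (\<Sum>i<n. y i) ^ d = (\<Sum>\<beta>\<in>multi_indices n d. m \<beta> * monomial n \<beta> y)"
proof -
  have "\<exists>m :: (nat \<Rightarrow> nat) \<Rightarrow> real. (\<forall>\<beta>\<in>multi_indices n d. m \<beta> > 0) \<and>
    (\<forall>y. (\<Sum>i<n. y i) ^ d = (\<Sum>\<beta>\<in>multi_indices n d. m \<beta> * monomial n \<beta> y))"
  proof (induction d)
    case 0
    show ?case
      by (rule exI[of _ "\<lambda>_. 1"]) (simp add: multi_indices_0 monomial_def)
  next
    case (Suc d)
    then obtain m :: "(nat \<Rightarrow> nat) \<Rightarrow> real"
      where pos: "\<And>\<beta>. \<beta> \<in> multi_indices n d \<Longrightarrow> m \<beta> > 0"
      and m: "\<And>y. (\<Sum>i<n. y i) ^ d = (\<Sum>\<beta>\<in>multi_indices n d. m \<beta> * monomial n \<beta> y)"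
      by blast
    \<comment> \<open>The share of the factor \<open>y j\<close> in the new coefficient of \<beta>;
      summing over \<open>j\<close> gives the Pascal-type recursion.\<close>
    define m' where "m' j \<beta> = (if \<beta> j > 0 then m (\<beta>(j := \<beta> j - 1)) else 0)" for j \<beta>
    have "(\<Sum>i<n. y i) ^ Suc d =
        (\<Sum>\<beta>\<in>multi_indices n (Suc d). (\<Sum>j<n. m' j \<beta>) * monomial n \<beta> y)" for y
    proof -
      have "(\<Sum>i<n. y i) ^ Suc d =
          (\<Sum>j<n. y j * (\<Sum>\<beta>\<in>multi_indices n d. m \<beta> * monomial n \<beta> y))"
        by (simp add: m sum_distrib_right)
      also have "\<dots> = (\<Sum>j<n. \<Sum>\<beta>\<in>multi_indices n (Suc d). m' j \<beta> * monomial n \<beta> y)"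
        by (simp add: var_times_form m'_def)
      finally show ?thesis
        by (subst (asm) sum.swap) (simp add: sum_distrib_right)
    qed
    moreover have "(\<Sum>j<n. m' j \<beta>) > 0" if \<beta>: "\<beta> \<in> multi_indices n (Suc d)" for \<beta>
    proof -
      have nonneg: "m' j \<beta> \<ge> 0" if "j < n" for j
        using pos[OF multi_indices_upd_pred[OF that \<beta>]] by (simp add: m'_def less_imp_le)
      \<comment> \<open>Since the degree is \<open>Suc d\<close>, some exponent is positive; its
        share is positive and the other shares are nonnegative.\<close>
      have "(\<Sum>j<n. \<beta> j) \<noteq> 0"
        using \<beta> by (simp add: multi_indices_def)
      then obtain j where j: "j < n" "\<beta> j > 0"
        by (metis sum.not_neutral_contains_not_neutral lessThan_iff gr0I)
      then have "m' j \<beta> > 0"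
        using pos[OF multi_indices_upd_pred[OF _ \<beta>]] by (simp add: m'_def)
      with j nonneg show ?thesis
        by (intro sum_pos2[of _ j]) auto
    qed
    ultimately show ?case
      by (intro exI[of _ "\<lambda>\<beta>. \<Sum>j<n. m' j \<beta>"]) blast
  qed
  then show ?thesis
    using that by blast
qed

section \<open>Products of linear forms and Lagrange polynomials\<close>

definition is_form :: "nat \<Rightarrow> nat \<Rightarrow> ((nat \<Rightarrow> real) \<Rightarrow> real) \<Rightarrow> bool" where
  "is_form n d f \<longleftrightarrow> (\<exists>c. \<forall>x. f x = (\<Sum>\<beta>\<in>multi_indices n d. c \<beta> * monomial n \<beta> x))"

lemma is_form_linear_times:
  assumes "is_form n d f"
  shows "is_form n (Suc d) (\<lambda>x. (\<Sum>j<n. a j * x j) * f x)"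
proof -
  obtain c where c: "\<And>x. f x = (\<Sum>\<beta>\<in>multi_indices n d. c \<beta> * monomial n \<beta> x)"
    using assms by (auto simp: is_form_def)
  define c' where "c' j \<beta> = (if \<beta> j > 0 then c (\<beta>(j := \<beta> j - 1)) else 0)" for j \<beta>
  have "(\<Sum>j<n. a j * x j) * f x =
      (\<Sum>\<beta>\<in>multi_indices n (Suc d). (\<Sum>j<n. a j * c' j \<beta>) * monomial n \<beta> x)" for x
  proof -
    have "(\<Sum>j<n. a j * x j) * f x =
        (\<Sum>j<n. a j * (x j * (\<Sum>\<beta>\<in>multi_indices n d. c \<beta> * monomial n \<beta> x)))"
      by (simp add: c sum_distrib_right mult.assoc)
    also have "\<dots> = (\<Sum>j<n. \<Sum>\<beta>\<in>multi_indices n (Suc d). a j * c' j \<beta> * monomial n \<beta> x)"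
      by (intro sum.cong refl) (simp add: var_times_form c'_def mult.assoc flip: sum_distrib_left)
    finally show ?thesis
      by (subst (asm) sum.swap) (simp add: sum_distrib_right)
  qed
  then show ?thesis
    unfolding is_form_def by (intro exI[of _ "\<lambda>\<beta>. \<Sum>j<n. a j * c' j \<beta>"]) blast
qed

lemma is_form_prod_linear:
  assumes "finite A"
  shows "is_form n (card A) (\<lambda>x. \<Prod>k\<in>A. \<Sum>j<n. a k j * x j)"
  using assms
proof (induction A)
  case empty
  show ?case
    unfolding is_form_def by (rule exI[of _ "\<lambda>_. 1"]) (simp add: multi_indices_0 monomial_def)
next
  case (insert k A)
  then show ?case
    using is_form_linear_times[OF insert.IH, of "a k"]
    by (simp only: prod.insert card_insert_disjoint not_False_eq_True)
qed

text \<open>Both sums equal \<open>d\<close>, which leaves no room for a strict inequality at any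
  index.\<close>

lemma multi_indices_eqI:
  assumes "\<alpha> \<in> multi_indices n d" "\<gamma> \<in> multi_indices n d" "\<And>i. i < n \<Longrightarrow> \<alpha> i \<le> \<gamma> i"
  shows "\<alpha> = \<gamma>"
proof (rule PiE_ext[where k = "{..<n}" and s = "\<lambda>_. UNIV"])
  show "\<alpha> \<in> {..<n} \<rightarrow>\<^sub>E UNIV" "\<gamma> \<in> {..<n} \<rightarrow>\<^sub>E UNIV"
    using assms(1,2) by (simp_all add: multi_indices_def)
  show "\<alpha> i = \<gamma> i" if "i \<in> {..<n}" for i
  proof (rule sum_mono_inv[of \<alpha> "{..<n}" \<gamma>])
    show "sum \<alpha> {..<n} = sum \<gamma> {..<n}"
      using assms(1,2) by (simp add: multi_indices_def)
  qed (use that assms(3) in simp_all)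
qed

text \<open>The coordinates of a multi-index of degree \<open>d\<close> sum to \<open>d\<close>, so
  subtracting \<open>k / d\<close> times their sum is a homogeneous way of subtracting the constant
  \<open>k\<close>.\<close>

lemma lagrange_form:
  assumes "d > 0" "\<alpha> \<in> multi_indices n d"
  obtains p where "is_form n d p"
    "\<And>\<gamma>. \<gamma> \<in> multi_indices n d \<Longrightarrow> p (\<lambda>i. real (\<gamma> i)) \<noteq> 0 \<longleftrightarrow> \<gamma> = \<alpha>"
proof
  \<comment> \<open>One linear factor for each pair \<open>(i, k)\<close> with
    \<open>k < \<alpha> i\<close>: the number of pairs is the sum of the \<open>\<alpha> i\<close>,
    so the product has degree \<open>d\<close>.\<close>
  define A where "A = Sigma {..<n} (\<lambda>i. {..<\<alpha> i})"
  define a where "a = (\<lambda>(i, k) j :: nat. (if j = i then 1 else 0) - real k / real d)"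
  define p where "p x = (\<Prod>u\<in>A. \<Sum>j<n. a u j * x j)" for x
  have "finite A" "card A = d"
    using assms by (simp_all add: A_def card_SigmaI multi_indices_def)
  then show "is_form n d p"
    using is_form_prod_linear[of A n a] by (simp add: p_def[abs_def])
  fix \<gamma> assume \<gamma>: "\<gamma> \<in> multi_indices n d"
  then have sum_\<gamma>: "(\<Sum>j<n. real (\<gamma> j)) = real d"
    by (simp add: multi_indices_def flip: of_nat_sum)
  have "(\<Sum>j<n. a (i, k) j * real (\<gamma> j)) = real (\<gamma> i) - real k" if "i < n" for i k
  proof -
    have "(\<Sum>j<n. a (i, k) j * real (\<gamma> j)) =
        (\<Sum>j<n. (if j = i then real (\<gamma> j) else 0) - real k / real d * real (\<gamma> j))"
      by (intro sum.cong) (auto simp: a_def left_diff_distrib)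
    also have "\<dots> = (\<Sum>j<n. if j = i then real (\<gamma> j) else 0) -
        real k / real d * (\<Sum>j<n. real (\<gamma> j))"
      by (simp only: sum_subtractf sum_distrib_left)
    also have "\<dots> = real (\<gamma> i) - real k"
      using that assms(1) unfolding sum_\<gamma> by (simp add: sum.delta)
    finally show ?thesis .
  qed
  then have "p (\<lambda>i. real (\<gamma> i)) = (\<Prod>(i, k)\<in>A. real (\<gamma> i) - real k)"
    unfolding p_def by (intro prod.cong) (auto simp: A_def)
  then have "p (\<lambda>i. real (\<gamma> i)) \<noteq> 0 \<longleftrightarrow> (\<forall>i<n. \<forall>k<\<alpha> i. \<gamma> i \<noteq> k)"
    using \<open>finite A\<close> by (auto simp: A_def)
  \<comment> \<open>A natural number that avoids every \<open>k < \<alpha> i\<close> is at least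
    \<open>\<alpha> i\<close>.\<close>
  also have "\<dots> \<longleftrightarrow> (\<forall>i<n. \<alpha> i \<le> \<gamma> i)"
    by (auto simp: not_less[symmetric])
  also have "\<dots> \<longleftrightarrow> \<gamma> = \<alpha>"
    using multi_indices_eqI[OF assms(2) \<gamma>] by auto
  finally show "p (\<lambda>i. real (\<gamma> i)) \<noteq> 0 \<longleftrightarrow> \<gamma> = \<alpha>" .
qed

section \<open>Matrix inversion, and forms as sums of powers of linear forms\<close>

lemma left_right_inverse_on:
  fixes A B :: "'a \<Rightarrow> 'a \<Rightarrow> 'b :: field"
  assumes "finite I"
    and AB: "\<And>i j. i \<in> I \<Longrightarrow> j \<in> I \<Longrightarrow> (\<Sum>k\<in>I. A i k * B k j) = (if i = j then 1 else 0)"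
    and "i \<in> I" "j \<in> I"
  shows "(\<Sum>k\<in>I. B i k * A k j) = (if i = j then 1 else 0)"
proof -
  let ?N = "card I"
  \<comment> \<open>Enumerating \<open>I\<close> turns both families into square matrices over a
    field, for which a one-sided inverse is two-sided.\<close>
  obtain e where e: "bij_betw e {0..<?N} I"
    using ex_bij_betw_nat_finite[OF assms(1)] by blast
  define MA where "MA = mat ?N ?N (\<lambda>(i, j). A (e i) (e j))"
  define MB where "MB = mat ?N ?N (\<lambda>(i, j). B (e i) (e j))"
  have eI: "e i \<in> I" if "i < ?N" for i
    using bij_betwE[OF e] that by auto
  have e_eq: "e i = e j \<longleftrightarrow> i = j" if "i < ?N" "j < ?N" for i j
    using inj_onD[OF bij_betw_imp_inj_on[OF e]] that by auto
  have "MA * MB = 1\<^sub>m ?N"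
    by (rule eq_matI)
      (auto simp: MA_def MB_def scalar_prod_def sum.reindex_bij_betw[OF e, of "\<lambda>k. A _ k * B k _"]
        AB eI e_eq)
  then have BA: "MB * MA = 1\<^sub>m ?N"
    by (rule mat_mult_left_right_inverse[rotated 2]) (simp_all add: MA_def MB_def)
  have "i \<in> e ` {0..<?N}" "j \<in> e ` {0..<?N}"
    using assms(3,4) by (simp_all only: bij_betw_imp_surj_on[OF e])
  then obtain i' j' where ij: "i' < ?N" "j' < ?N" "i = e i'" "j = e j'"
    by auto
  have "(\<Sum>k\<in>I. B i k * A k j) = (MB * MA) $$ (i', j')"
    using ij by (simp add: MA_def MB_def scalar_prod_def
        sum.reindex_bij_betw[OF e, of "\<lambda>k. B _ k * A k _"])
  also have "\<dots> = (if i = j then 1 else 0)"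
    using ij by (simp add: BA e_eq)
  finally show ?thesis .
qed

text \<open>Comparing coefficients of each monomial leaves the linear system
  \<open>(\<Sum>\<gamma>\<in>?I. a \<gamma> * \<gamma>^\<beta>) = c \<beta> / m \<beta>\<close>,
  with \<open>m\<close> the multinomial coefficients and \<open>\<gamma>^\<beta>\<close> short for
  the monomial \<beta> at \<gamma>.\<close>

lemma form_eq_sum_powers:
  assumes "d > 0"
  obtains a where "\<And>x. (\<Sum>\<beta>\<in>multi_indices n d. c \<beta> * monomial n \<beta> x) =
    (\<Sum>\<gamma>\<in>multi_indices n d. a \<gamma> * (\<Sum>i<n. real (\<gamma> i) * x i) ^ d)"
proof -
  let ?I = "multi_indices n d"
  have "\<exists>l. \<forall>\<gamma>\<in>?I. (\<Sum>\<beta>\<in>?I. l \<beta> * monomial n \<beta> (\<lambda>i. real (\<gamma> i))) = (if \<alpha> = \<gamma> then 1 else 0)"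
    if \<alpha>: "\<alpha> \<in> ?I" for \<alpha>
  proof -
    obtain p where p: "is_form n d p" "\<And>\<gamma>. \<gamma> \<in> ?I \<Longrightarrow> p (\<lambda>i. real (\<gamma> i)) \<noteq> 0 \<longleftrightarrow> \<gamma> = \<alpha>"
      using lagrange_form[OF assms \<alpha>] by blast
    then obtain l where l: "\<And>x. p x = (\<Sum>\<beta>\<in>?I. l \<beta> * monomial n \<beta> x)"
      by (auto simp: is_form_def)
    \<comment> \<open>Dividing by this nonzero value normalises the Lagrange form to 1 at
      \<alpha>.\<close>
    let ?q = "p (\<lambda>i. real (\<alpha> i))"
    have "(\<Sum>\<beta>\<in>?I. l \<beta> / ?q * monomial n \<beta> x) = p x / ?q" for x
      unfolding l sum_divide_distrib by (rule sum.cong) auto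
    then show ?thesis
      using p(2) \<alpha> by (intro exI[of _ "\<lambda>\<beta>. l \<beta> / ?q"]) auto
  qed
  then obtain l where "\<And>\<alpha> \<gamma>. \<alpha> \<in> ?I \<Longrightarrow> \<gamma> \<in> ?I \<Longrightarrow>
      (\<Sum>\<beta>\<in>?I. l \<alpha> \<beta> * monomial n \<beta> (\<lambda>i. real (\<gamma> i))) = (if \<alpha> = \<gamma> then 1 else 0)"
    by metis
  \<comment> \<open>The Lagrange conditions make \<open>l\<close> a left inverse of the matrix of
    monomial values; solving the system takes a right inverse.\<close>
  then have inv: "(\<Sum>\<gamma>\<in>?I. monomial n \<beta> (\<lambda>i. real (\<gamma> i)) * l \<gamma> \<beta>') = (if \<beta> = \<beta>' then 1 else 0)"
    if "\<beta> \<in> ?I" "\<beta>' \<in> ?I" for \<beta> \<beta>'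
    using left_right_inverse_on[of ?I l "\<lambda>\<beta> \<gamma>. monomial n \<beta> (\<lambda>i. real (\<gamma> i))"] that by simp
  obtain m where m: "\<And>\<beta>. \<beta> \<in> ?I \<Longrightarrow> m \<beta> > 0"
    "\<And>y. (\<Sum>i<n. y i) ^ d = (\<Sum>\<beta>\<in>?I. m \<beta> * monomial n \<beta> y)"
    using multinomial_theorem by blast
  \<comment> \<open>The right-hand side \<open>c \<beta> / m \<beta>\<close> multiplied by the
    inverse matrix \<open>l\<close>.\<close>
  define a where "a \<gamma> = (\<Sum>\<beta>\<in>?I. l \<gamma> \<beta> * (c \<beta> / m \<beta>))" for \<gamma>
  have a: "(\<Sum>\<gamma>\<in>?I. a \<gamma> * monomial n \<beta> (\<lambda>i. real (\<gamma> i))) = c \<beta> / m \<beta>" if "\<beta> \<in> ?I" for \<beta>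
  proof -
    have "(\<Sum>\<gamma>\<in>?I. a \<gamma> * monomial n \<beta> (\<lambda>i. real (\<gamma> i))) =
        (\<Sum>\<gamma>\<in>?I. \<Sum>\<beta>'\<in>?I. monomial n \<beta> (\<lambda>i. real (\<gamma> i)) * l \<gamma> \<beta>' * (c \<beta>' / m \<beta>'))"
      by (simp add: a_def sum_distrib_left sum_distrib_right mult_ac)
    also have "\<dots> = (\<Sum>\<beta>'\<in>?I. (if \<beta> = \<beta>' then 1 else 0) * (c \<beta>' / m \<beta>'))"
      by (subst sum.swap) (intro sum.cong refl, simp only: inv[OF that] flip: sum_distrib_right)
    also have "\<dots> = (\<Sum>\<beta>'\<in>?I. if \<beta> = \<beta>' then c \<beta>' / m \<beta>' else 0)"
      by (rule sum.cong) auto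
    finally show ?thesis
      using that by simp
  qed
  have "(\<Sum>\<gamma>\<in>?I. a \<gamma> * (\<Sum>i<n. real (\<gamma> i) * x i) ^ d) = (\<Sum>\<beta>\<in>?I. c \<beta> * monomial n \<beta> x)" for x
  proof -
    have "(\<Sum>\<gamma>\<in>?I. a \<gamma> * (\<Sum>i<n. real (\<gamma> i) * x i) ^ d) =
        (\<Sum>\<gamma>\<in>?I. \<Sum>\<beta>\<in>?I. a \<gamma> * monomial n \<beta> (\<lambda>i. real (\<gamma> i)) * (m \<beta> * monomial n \<beta> x))"
      by (simp add: m(2) monomial_mult sum_distrib_left mult_ac)
    also have "\<dots> = (\<Sum>\<beta>\<in>?I. c \<beta> / m \<beta> * (m \<beta> * monomial n \<beta> x))"
      by (subst sum.swap) (simp add: a flip: sum_distrib_right)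
    also have "\<dots> = (\<Sum>\<beta>\<in>?I. c \<beta> * monomial n \<beta> x)"
      using m(1) by (intro sum.cong refl) (simp add: less_imp_neq[symmetric])
    finally show ?thesis .
  qed
  then show ?thesis
    by (rule that[OF sym])
qed

section \<open>Two-layer networks as sums of powers\<close>

lemma Sym_iff: "f \<in> Sym d n \<longleftrightarrow>
  (\<exists>c. f = (\<lambda>x\<in>carrier_vec n. \<Sum>\<beta>\<in>multi_indices n d. c \<beta> * monomial n \<beta> (($) x)))"
  by (simp add: Sym_def monomial_def)

text \<open>Expand each power by the multinomial theorem and collect the coefficients of each
  monomial. This is what puts every network output into \<open>Sym\<close>.\<close>

lemma sum_powers_in_Sym:
  "(\<lambda>x\<in>carrier_vec n. \<Sum>i\<in>A. b i * (\<Sum>k<n. w i k * x $ k) ^ d) \<in> Sym d n"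
proof -
  obtain m where m: "\<And>y. (\<Sum>i<n. y i) ^ d = (\<Sum>\<beta>\<in>multi_indices n d. m \<beta> * monomial n \<beta> y)"
    using multinomial_theorem by blast
  define c where "c \<beta> = (\<Sum>i\<in>A. b i * m \<beta> * monomial n \<beta> (w i))" for \<beta>
  have "(\<Sum>i\<in>A. b i * (\<Sum>k<n. w i k * x $ k) ^ d) =
      (\<Sum>\<beta>\<in>multi_indices n d. c \<beta> * monomial n \<beta> (($) x))" for x
    unfolding m monomial_mult c_def sum_distrib_left sum_distrib_right
    by (subst sum.swap) (simp add: mult_ac)
  then show ?thesis
    unfolding Sym_iff by auto
qed

text \<open>The rows of \<open>W1\<close> are the linear forms being raised to the power
  \<open>r\<close>, and row \<open>j\<close> of \<open>W2\<close> holds the coefficients of their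
  combination.\<close>

lemma pnn_two_layers_index:
  assumes "W1 \<in> carrier_mat d1 d0" "W2 \<in> carrier_mat d2 d1" "x \<in> carrier_vec d0" "j < d2"
  shows "pnn r [W1, W2] x $ j =
    (\<Sum>i<d1. W2 $$ (j, i) * (\<Sum>k<d0. W1 $$ (i, k) * x $ k) ^ r)"
  using assms by (simp add: activation_def scalar_prod_def atLeast0LessThan)

lemma neuromanifold_two_layers:
  "neuromanifold [d0, d1, d2] r =
    (\<lambda>(W1, W2). \<lambda>x\<in>carrier_vec d0. pnn r [W1, W2] x) ` (carrier_mat d1 d0 \<times> carrier_mat d2 d1)"
proof -
  have "weights [d0, d1, d2] = (\<lambda>(W1, W2). [W1, W2]) ` (carrier_mat d1 d0 \<times> carrier_mat d2 d1)"
  proof (intro subset_antisym subsetI)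
    fix Ws assume "Ws \<in> weights [d0, d1, d2]"
    then show "Ws \<in> (\<lambda>(W1, W2). [W1, W2]) ` (carrier_mat d1 d0 \<times> carrier_mat d2 d1)"
      by (auto simp: weights_def Suc_length_conv length_Suc_conv All_less_Suc)
  qed (auto simp: weights_def less_Suc_eq)
  then show ?thesis
    by (simp add: neuromanifold_def param_map_def image_image case_prod_unfold del: pnn.simps)
qed

theorem proposition3p7:
  fixes d0 d1 d2 r :: nat
  assumes "d0 > 0" and "d1 > 0" and "d2 > 0" and "r > 0"
    and "d1 \<ge> (r + d0 - 1) choose r"
  shows "neuromanifold [d0, d1, d2] r = Sym_tuples r d0 d2"
proof
  show "neuromanifold [d0, d1, d2] r \<subseteq> Sym_tuples r d0 d2"
  proof
    fix F assume "F \<in> neuromanifold [d0, d1, d2] r"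
    then obtain W1 W2 where W: "W1 \<in> carrier_mat d1 d0" "W2 \<in> carrier_mat d2 d1"
      and F: "F = (\<lambda>x\<in>carrier_vec d0. pnn r [W1, W2] x)"
      by (auto simp: neuromanifold_two_layers simp del: pnn.simps)
    have "(\<lambda>x\<in>carrier_vec d0. F x $ j) \<in> Sym r d0" if "j < d2" for j
    proof -
      have "(\<lambda>x\<in>carrier_vec d0. F x $ j) = (\<lambda>x\<in>carrier_vec d0.
          \<Sum>i<d1. W2 $$ (j, i) * (\<Sum>k<d0. W1 $$ (i, k) * x $ k) ^ r)"
        using that by (auto simp: F pnn_two_layers_index[OF W] fun_eq_iff simp del: pnn.simps)
      then show ?thesis
        using sum_powers_in_Sym by simp
    qed
    moreover have "F \<in> carrier_vec d0 \<rightarrow>\<^sub>E carrier_vec d2"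
      using W by (auto simp: F intro!: carrier_vecI)
    ultimately show "F \<in> Sym_tuples r d0 d2"
      by (simp add: Sym_tuples_def)
  qed
  show "Sym_tuples r d0 d2 \<subseteq> neuromanifold [d0, d1, d2] r"
  proof
    fix F assume "F \<in> Sym_tuples r d0 d2"
    then have F: "F \<in> carrier_vec d0 \<rightarrow>\<^sub>E carrier_vec d2"
      and Sym_F: "\<And>j. j < d2 \<Longrightarrow> (\<lambda>x\<in>carrier_vec d0. F x $ j) \<in> Sym r d0"
      by (auto simp: Sym_tuples_def)
    let ?I = "multi_indices d0 r"
    \<comment> \<open>Only the coefficients depend on \<open>j\<close>; the linear forms do not, so
      a single first layer serves all outputs.\<close>
    have "\<forall>j<d2. \<exists>a. \<forall>x\<in>carrier_vec d0.
        F x $ j = (\<Sum>\<gamma>\<in>?I. a \<gamma> * (\<Sum>k<d0. real (\<gamma> k) * x $ k) ^ r)"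
    proof (intro allI impI)
      fix j assume j: "j < d2"
      obtain c where c: "(\<lambda>x\<in>carrier_vec d0. F x $ j) =
          (\<lambda>x\<in>carrier_vec d0. \<Sum>\<beta>\<in>?I. c \<beta> * monomial d0 \<beta> (($) x))"
        using Sym_F[OF j] unfolding Sym_iff by blast
      obtain a where a: "\<And>x. (\<Sum>\<beta>\<in>?I. c \<beta> * monomial d0 \<beta> x) =
          (\<Sum>\<gamma>\<in>?I. a \<gamma> * (\<Sum>i<d0. real (\<gamma> i) * x i) ^ r)"
        using form_eq_sum_powers[OF assms(4)] by blast
      have "F x $ j = (\<Sum>\<gamma>\<in>?I. a \<gamma> * (\<Sum>k<d0. real (\<gamma> k) * x $ k) ^ r)"
        if "x \<in> carrier_vec d0" for x
        using fun_cong[OF c, of x] that by (simp add: a)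
      then show "\<exists>a. \<forall>x\<in>carrier_vec d0.
          F x $ j = (\<Sum>\<gamma>\<in>?I. a \<gamma> * (\<Sum>k<d0. real (\<gamma> k) * x $ k) ^ r)"
        by blast
    qed
    then obtain a where a: "\<forall>j<d2. \<forall>x\<in>carrier_vec d0.
        F x $ j = (\<Sum>\<gamma>\<in>?I. a j \<gamma> * (\<Sum>k<d0. real (\<gamma> k) * x $ k) ^ r)"
      unfolding choice_iff' by blast
    \<comment> \<open>The width bound enters here: there is a hidden unit for each
      multi-index.\<close>
    have card: "card ?I \<le> d1"
      using assms card_multi_indices by simp
    obtain e where e: "bij_betw e {..<card ?I} ?I"
      using ex_bij_betw_nat_finite[of ?I] by (auto simp: atLeast0LessThan)
    define W1 where "W1 = mat d1 d0 (\<lambda>(i, k). real (e i k))"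
    \<comment> \<open>Beyond \<open>card ?I\<close> the values of \<open>e\<close>, and so the rows
      of \<open>W1\<close>, are unspecified; the zero weights cancel these surplus units.\<close>
    define W2 where "W2 = mat d2 d1 (\<lambda>(j, i). if i < card ?I then a j (e i) else 0)"
    have W: "W1 \<in> carrier_mat d1 d0" "W2 \<in> carrier_mat d2 d1"
      by (simp_all add: W1_def W2_def)
    have "pnn r [W1, W2] x $ j = F x $ j" if x: "x \<in> carrier_vec d0" and j: "j < d2" for x j
    proof -
      let ?p = "\<lambda>\<gamma>. a j \<gamma> * (\<Sum>k<d0. real (\<gamma> k) * x $ k) ^ r"
      have "pnn r [W1, W2] x $ j = (\<Sum>i<d1. if i < card ?I then ?p (e i) else 0)"
        unfolding pnn_two_layers_index[OF W x j]
        using j by (intro sum.cong) (auto simp: W1_def W2_def)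
      also have "\<dots> = (\<Sum>i<card ?I. ?p (e i))"
        using card by (intro sum.mono_neutral_cong_right) auto
      also have "\<dots> = (\<Sum>\<gamma>\<in>?I. ?p \<gamma>)"
        by (rule sum.reindex_bij_betw[OF e])
      finally show ?thesis
        using a j x by simp
    qed
    then have "F x = pnn r [W1, W2] x" if "x \<in> carrier_vec d0" for x
      using that PiE_mem[OF F that] W by (intro eq_vecI) auto
    \<comment> \<open>Both sides are \<open>undefined\<close> off \<open>carrier_vec d0\<close>, so
      agreement on it is enough.\<close>
    then have "F = (\<lambda>x\<in>carrier_vec d0. pnn r [W1, W2] x)"
      using F by (intro extensionalityI[of _ "carrier_vec d0"]) (auto simp: PiE_def)
    then show "F \<in> neuromanifold [d0, d1, d2] r"
      unfolding neuromanifold_two_layers using W by (intro image_eqI[of _ _ "(W1, W2)"]) auto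
  qed
qed

end
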